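(* Let $\Gamma$ be a probability measure on $\mathbb{R}$ with $\Gamma((-\infty,0))>0$, and let $\Phi$ be the random walk on the half line $\mathbb{R}_+=[0,\infty)$ with increment law $\Gamma$. Let $\beta=\int_{-\infty}^{\infty}x\,\Gamma(dx)$. Assume that $\beta>0$ and that there exists $\gamma>0$ such that $$\int_{-\infty}^{0}\exp(-\gamma x)\,\Gamma(dx)<\infty.$$ Then $\Phi$ is geometrically transient.
   Context: The random walk on the half line is the Markov chain $\Phi=\{\Phi_n:n\in\mathbb{Z}_+\}$ on $X=[0,\infty)$ (Borel $\sigma$-field $\mathcal{B}(X)$) defined by an arbitrary distribution for $\Phi_0$ and $\Phi_{n+1}=\max(0,\Phi_n+U_{n+1})$, where $(U_n)$ are i.i.d. real random variables (independent of $\Phi_0$) with $\mathbb{P}(U\le x)=\Gamma(-\infty,x]$. $P^n(x,A)=\mathbb{P}_x\{\Phi_n\in A\}$ is its $n$-step transition kernel. When $\Gamma((-\infty,0))>0$ the chain is $\psi$-irreducible with maximal irreducibility measure $\psi(A)=\sum_n P^n(0,A)2^{-n}$ (so $\psi(\{0\})>0$). Irreducibility notions: a chain is $\psi$-irreducible with $\psi$ a maximal irreducibility measure if $\psi$ is a nontrivial $\sigma$-finite measure such that $\psi(A)>0$ implies that for every $x\in X$ there is $n\ge1$ with $P^n(x,A)>0$, and every other measure with this property is absolutely continuous with respect to $\psi$. $\mathcal{B}^{+}(X)=\{A\in\mathcal{B}(X):\psi(A)>0\}$. Geometric transience: a set $A\in\mathcal{B}^{+}(X)$ is called uniformly geometric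 transient if there is a constant $\kappa>1$ with $\sup_{x\in A}\sum_{n=1}^{\infty}\kappa^{n}P^{n}(x,A)<\infty$. The chain is geometrically transient if it is $\psi$-irreducible and there exist sets $D$ and $A_i$, $i=1,2,\dots$ with $X=D\cup\bigcup_{i=1}^{\infty}A_i$, $\psi(D)=0$, and each $A_i$ uniformly geometric transient. *)

theory Defs
  imports "HOL-Probability.Probability"
begin

section \<open>Geometric transience\<close>

text \<open>
  A Markov chain on the measurable space \<open>X\<close> enters the definitions through its transition
  probabilities only: \<open>P n x\<close> is the law of the chain at time \<open>n\<close> when started in \<open>x\<close>.
\<close>

definition irreducibility_measure ::
  "'a measure \<Rightarrow> (nat \<Rightarrow> 'a \<Rightarrow> 'a measure) \<Rightarrow> 'a measure \<Rightarrow> bool" where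
  "irreducibility_measure X P \<phi> \<longleftrightarrow>
     sets \<phi> = sets X \<and> sigma_finite_measure \<phi> \<and> emeasure \<phi> (space X) > 0 \<and>
     (\<forall>A\<in>sets X. emeasure \<phi> A > 0 \<longrightarrow> (\<forall>x\<in>space X. \<exists>n\<ge>1. emeasure (P n x) A > 0))"

text \<open>The library's \<open>absolutely_continuous \<psi> \<phi>\<close> reads \<open>\<phi> \<lless> \<psi>\<close>.\<close>

definition maximal_irreducibility_measure ::
  "'a measure \<Rightarrow> (nat \<Rightarrow> 'a \<Rightarrow> 'a measure) \<Rightarrow> 'a measure \<Rightarrow> bool" where
  "maximal_irreducibility_measure X P \<psi> \<longleftrightarrow>
     irreducibility_measure X P \<psi> \<and>
     (\<forall>\<phi>. irreducibility_measure X P \<phi> \<longrightarrow> absolutely_continuous \<psi> \<phi>)"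

definition uniformly_geometric_transient ::
  "'a measure \<Rightarrow> (nat \<Rightarrow> 'a \<Rightarrow> 'a measure) \<Rightarrow> 'a measure \<Rightarrow> 'a set \<Rightarrow> bool" where
  "uniformly_geometric_transient X P \<psi> A \<longleftrightarrow>
     A \<in> sets X \<and> emeasure \<psi> A > 0 \<and>
     (\<exists>\<kappa>::real. \<kappa> > 1 \<and>
        (SUP x\<in>A. \<Sum>n. ennreal (\<kappa> ^ Suc n) * emeasure (P (Suc n) x) A) < \<infinity>)"

text \<open>
  Any two maximal irreducibility measures have the same null sets, so the choice of \<open>\<psi>\<close> is
  immaterial.
\<close>

definition geometrically_transient ::
  "'a measure \<Rightarrow> (nat \<Rightarrow> 'a \<Rightarrow> 'a measure) \<Rightarrow> bool" where
  "geometrically_transient X P \<longleftrightarrow>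
     (\<exists>\<psi>. maximal_irreducibility_measure X P \<psi> \<and>
        (\<exists>D. \<exists>A :: nat \<Rightarrow> 'a set.
           D \<in> null_sets \<psi> \<and> space X = D \<union> (\<Union>i. A i) \<and>
           (\<forall>i. uniformly_geometric_transient X P \<psi> (A i))))"

section \<open>The random walk on the half line\<close>

definition half_line :: "real measure" where
  "half_line = restrict_space borel {0..}"

text \<open>The path started in \<open>x\<close> with increments \<open>u 1, u 2, \<dots>\<close>; the value \<open>u 0\<close> is not used.\<close>

primrec half_line_walk :: "real \<Rightarrow> (nat \<Rightarrow> real) \<Rightarrow> nat \<Rightarrow> real" where
  "half_line_walk x u 0 = x"
| "half_line_walk x u (Suc n) = max 0 (half_line_walk x u n + u (Suc n))"

text \<open>
  The law of the walk at time \<open>n\<close> when started in \<open>x\<close>. The increments are the coordinates of the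
  infinite product of copies of \<open>\<Gamma>\<close>, the canonical realisation of an i.i.d. sequence; lemma
  \<open>distr_half_line_walk\<close> shows that any other realisation gives the same law.
\<close>

definition half_line_kernel :: "real measure \<Rightarrow> nat \<Rightarrow> real \<Rightarrow> real measure" where
  "half_line_kernel \<Gamma> n x =
     distr (\<Pi>\<^sub>M i\<in>UNIV. \<Gamma>) half_line (\<lambda>u. half_line_walk x u n)"

text \<open>
  The mean as an extended real, so that \<open>\<infinity>\<close> is a possible value. Note that \<open>ennreal\<close> maps negative
  reals to \<open>0\<close>, so the two integrals are those of the positive and the negative part. The value is
  meaningful if one of them is finite.
\<close>

definition extended_mean :: "real measure \<Rightarrow> ereal" where
  "extended_mean \<Gamma> =
     enn2ereal (\<integral>\<^sup>+x. ennreal x \<partial>\<Gamma>) - enn2ereal (\<integral>\<^sup>+x. ennreal (- x) \<partial>\<Gamma>)"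

lemma half_line_walk_nonneg: "0 \<le> x \<Longrightarrow> 0 \<le> half_line_walk x u n"
  by (cases n) auto

lemma measurable_half_line_walk:
  assumes "0 \<le> x" and [measurable_cong]: "\<And>i. sets (N i) = sets borel"
  shows "(\<lambda>u. half_line_walk x u n) \<in> (\<Pi>\<^sub>M i\<in>UNIV. N i) \<rightarrow>\<^sub>M half_line"
proof -
  have "(\<lambda>u. half_line_walk x u n) \<in> borel_measurable (\<Pi>\<^sub>M i\<in>UNIV. N i)"
    by (induction n) simp_all
  then show ?thesis
    using assms(1)
    by (auto simp: half_line_def half_line_walk_nonneg intro!: measurable_restrict_space2)
qed

lemma distr_half_line_walk:
  assumes "prob_space M" and "prob_space.indep_vars M (\<lambda>_. borel) U UNIV"
    and "\<And>i. distr M borel (U i) = \<Gamma>" and "0 \<le> x"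
  shows "distr M half_line (\<lambda>\<omega>. half_line_walk x (\<lambda>i. U i \<omega>) n) = half_line_kernel \<Gamma> n x"
proof -
  interpret prob_space M by fact
  have U: "U i \<in> borel_measurable M" for i
    using assms(2) by (auto simp: indep_vars_def)
  have *: "distr M (\<Pi>\<^sub>M i\<in>UNIV. borel) (\<lambda>\<omega>. \<lambda>i\<in>UNIV. U i \<omega>) = (\<Pi>\<^sub>M i\<in>UNIV. \<Gamma>)"
    using assms(2,3) U by (subst (asm) indep_vars_iff_distr_eq_PiM') auto
  have m: "(\<lambda>\<omega>. \<lambda>i\<in>UNIV. U i \<omega>) \<in> M \<rightarrow>\<^sub>M (\<Pi>\<^sub>M i\<in>UNIV. borel)"
    using U by (intro measurable_restrict) auto
  show ?thesis
    unfolding half_line_kernel_def *[symmetric]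
    by (subst distr_distr[OF measurable_half_line_walk m]) (auto simp: assms(4) o_def restrict_UNIV)
qed

end

(*
  The walk started in x dominates the unreflected walk x + U_1 + ... + U_n, so Markov's inequality
  for exp (- t * _) gives P^n(x, [0, c]) <= exp (t * (c - x)) * M(t)^n with M(t) = E exp (- t * U).
  The exponential moment of the negative part and the positive mean yield M(t) < 1 for some t > 0.
  Then each [0, i] is uniformly geometric transient with any rate kappa < 1 / M(t), and these sets
  cover the half line. Irreducibility holds because the walk reaches 0 from everywhere by taking
  enough steps of size at most -epsilon < 0.
*)
theory Submission
  imports Defs
begin

section \<open>First-step analysis\<close>

lemma space_half_line: "space half_line = {0..}"
  by (simp add: half_line_def space_restrict_space)

lemma sets_half_lineD: "A \<in> sets half_line \<Longrightarrow> A \<in> sets borel"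
  by (auto simp: half_line_def sets_restrict_space)

lemma atLeastAtMost_half_line: "{0..c} \<in> sets half_line"
  by (auto simp: half_line_def sets_restrict_space image_iff intro!: bexI[of _ "{0..c}"])

text \<open>\<open>case_nat s \<omega>\<close> puts \<open>s\<close> at the index 0, which the walk
  never reads, and shifts \<open>\<omega>\<close> by one. The first step thus consumes
  \<open>\<omega> 0\<close>, and what is left is again a walk along \<open>\<omega>\<close> with
  index 0 unread.\<close>

lemma half_line_walk_case_nat:
  "half_line_walk x (case_nat s \<omega>) (Suc n) = half_line_walk (max 0 (x + \<omega> 0)) \<omega> n"
  by (induction n) auto

lemma half_line_walk_case_nat_irrel:
  "half_line_walk x (case_nat s \<omega>) n = half_line_walk x (case_nat 0 \<omega>) n"
  by (induction n) auto

context
  fixes \<Gamma> :: "real measure"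
  assumes prob: "prob_space \<Gamma>" and sets_eq [measurable_cong]: "sets \<Gamma> = sets borel"
begin

interpretation prob_space \<Gamma> by (rule prob)
interpretation product_prob_space "\<lambda>_. \<Gamma>" "UNIV :: nat set" ..
interpretation sequence_space \<Gamma> ..

lemma half_line_kernel_in_prob_algebra:
  assumes "0 \<le> x"
  shows "half_line_kernel \<Gamma> n x \<in> space (prob_algebra half_line)"
proof -
  have "(\<lambda>u. half_line_walk x u n) \<in> S \<rightarrow>\<^sub>M half_line"
    using assms sets_eq by (intro measurable_half_line_walk)
  then show ?thesis
    by (auto simp: half_line_kernel_def space_prob_algebra intro: P.prob_space_distr)
qed

text \<open>Putting an independent increment in front of an i.i.d. sequence does not change its law
  (\<open>PiM_iter\<close>); Tonelli then splits the integral.\<close>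

lemma nn_integral_case_nat:
  assumes f: "f \<in> borel_measurable S"
  shows "(\<integral>\<^sup>+\<omega>. f \<omega> \<partial>S) = (\<integral>\<^sup>+s. \<integral>\<^sup>+\<omega>. f (case_nat s \<omega>) \<partial>S \<partial>\<Gamma>)"
proof -
  have m: "(\<lambda>(s, \<omega>). case_nat s \<omega>) \<in> \<Gamma> \<Otimes>\<^sub>M S \<rightarrow>\<^sub>M S"
    by measurable
  have "(\<integral>\<^sup>+\<omega>. f \<omega> \<partial>S) = (\<integral>\<^sup>+p. f (case p of (s, \<omega>) \<Rightarrow> case_nat s \<omega>) \<partial>(\<Gamma> \<Otimes>\<^sub>M S))"
    by (subst PiM_iter [symmetric], rule nn_integral_distr) (use f m in auto)
  also have "\<dots> = (\<integral>\<^sup>+s. \<integral>\<^sup>+\<omega>. f (case_nat s \<omega>) \<partial>S \<partial>\<Gamma>)"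
    using measurable_compose[OF m f] by (subst P.nn_integral_fst [symmetric]) auto
  finally show ?thesis .
qed

lemma borel_measurable_half_line_walk [measurable]:
  assumes [measurable]: "f \<in> borel_measurable N" "\<And>i. (\<lambda>z. g z i) \<in> borel_measurable N"
  shows "(\<lambda>z. half_line_walk (f z) (g z) n) \<in> borel_measurable N"
  by (induction n) simp_all

text \<open>With the unread coordinate set to 0, the walk runs on the coordinates of
  \<open>\<omega>\<close> from index 0 on. This is the form to which the first-step identity for
  \<open>case_nat\<close> applies.\<close>

lemma emeasure_half_line_kernel:
  assumes "0 \<le> x" "A \<in> sets half_line"
  shows "emeasure (half_line_kernel \<Gamma> n x) A
      = (\<integral>\<^sup>+\<omega>. indicator A (half_line_walk x (case_nat 0 \<omega>) n) \<partial>S)"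
proof -
  have [measurable]: "A \<in> sets borel"
    using assms(2) by (rule sets_half_lineD)
  have m: "(\<lambda>u. half_line_walk x u n) \<in> S \<rightarrow>\<^sub>M half_line"
    using assms sets_eq by (intro measurable_half_line_walk)
  have "emeasure (half_line_kernel \<Gamma> n x) A = (\<integral>\<^sup>+y. indicator A y \<partial>half_line_kernel \<Gamma> n x)"
    using assms(2) by (subst nn_integral_indicator) (auto simp: half_line_kernel_def)
  also have "\<dots> = (\<integral>\<^sup>+\<omega>. indicator A (half_line_walk x \<omega> n) \<partial>S)"
    unfolding half_line_kernel_def using m assms(2) by (subst nn_integral_distr) auto
  also have "\<dots> = (\<integral>\<^sup>+s. \<integral>\<^sup>+\<omega>. indicator A (half_line_walk x (case_nat s \<omega>) n) \<partial>S \<partial>\<Gamma>)"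
    by (rule nn_integral_case_nat) measurable
  also have "\<dots> = (\<integral>\<^sup>+s. \<integral>\<^sup>+\<omega>. indicator A (half_line_walk x (case_nat 0 \<omega>) n) \<partial>S \<partial>\<Gamma>)"
    by (subst half_line_walk_case_nat_irrel) (rule refl)
  finally show ?thesis
    by (simp add: prob_space.emeasure_space_1[OF prob])
qed

lemma half_line_kernel_0:
  assumes "0 \<le> x" "A \<in> sets half_line"
  shows "emeasure (half_line_kernel \<Gamma> 0 x) A = indicator A x"
  using assms by (simp add: emeasure_half_line_kernel P.emeasure_space_1)

lemma half_line_kernel_Suc:
  assumes "0 \<le> x" "A \<in> sets half_line"
  shows "emeasure (half_line_kernel \<Gamma> (Suc n) x) A
      = (\<integral>\<^sup>+s. emeasure (half_line_kernel \<Gamma> n (max 0 (x + s))) A \<partial>\<Gamma>)"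
proof -
  have [measurable]: "A \<in> sets borel"
    using assms(2) by (rule sets_half_lineD)
  have [measurable]: "(\<lambda>\<omega>. \<omega> i) \<in> borel_measurable S" for i
    by measurable
  have meas: "(\<lambda>\<omega>. indicator A (half_line_walk (max 0 (x + \<omega> 0)) \<omega> n)) \<in> borel_measurable S"
    by measurable
  have "emeasure (half_line_kernel \<Gamma> (Suc n) x) A
      = (\<integral>\<^sup>+\<omega>. indicator A (half_line_walk (max 0 (x + \<omega> 0)) \<omega> n) \<partial>S)"
    using assms by (simp only: emeasure_half_line_kernel half_line_walk_case_nat)
  \<comment> \<open>The coordinate \<open>\<omega> 0\<close> is split off as the first increment
    \<open>s\<close>. It also heads the remaining path, but at the index that the walk does not
    read.\<close>
  also have "\<dots> = (\<integral>\<^sup>+s. \<integral>\<^sup>+\<omega>. indicator A (half_line_walk (max 0 (x + s)) (case_nat s \<omega>) n) \<partial>S \<partial>\<Gamma>)"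
    by (subst nn_integral_case_nat[OF meas]) simp
  also have "\<dots> = (\<integral>\<^sup>+s. \<integral>\<^sup>+\<omega>. indicator A (half_line_walk (max 0 (x + s)) (case_nat 0 \<omega>) n) \<partial>S \<partial>\<Gamma>)"
    by (subst half_line_walk_case_nat_irrel) (rule refl)
  finally show ?thesis
    using assms(2) by (simp add: emeasure_half_line_kernel)
qed

lemma borel_measurable_half_line_kernel:
  assumes "A \<in> sets half_line"
  shows "(\<lambda>s. emeasure (half_line_kernel \<Gamma> n (max 0 (x + s))) A) \<in> borel_measurable \<Gamma>"
proof -
  have [measurable]: "A \<in> sets borel"
    using assms by (rule sets_half_lineD)
  show ?thesis
    using assms by (subst emeasure_half_line_kernel) (simp, simp, measurable)
qed

section \<open>Irreducibility\<close>

text \<open>Each increment is at most \<open>-\<epsilon>\<close> with positive probability, and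
  \<open>k\<close> such increments bring the walk from \<open>x\<close> to 0. Reflection keeps it
  there if it arrives early, so the same \<open>k\<close> serves all \<open>x\<close> up to
  \<open>k * \<epsilon>\<close>.\<close>

lemma half_line_kernel_pos:
  assumes "0 \<le> \<epsilon>" "emeasure \<Gamma> {..-\<epsilon>} > 0" and A: "A \<in> sets half_line"
    and "emeasure (half_line_kernel \<Gamma> m 0) A > 0" "0 \<le> x" "x \<le> real k * \<epsilon>"
  shows "emeasure (half_line_kernel \<Gamma> (k + m) x) A > 0"
  using assms(5,6)
proof (induction k arbitrary: x)
  case 0
  then show ?case
    using assms(4) by simp
next
  case (Suc k)
  let ?f = "\<lambda>s. emeasure (half_line_kernel \<Gamma> (k + m) (max 0 (x + s))) A"
  have pos: "?f s > 0" if "s \<le> -\<epsilon>" for s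
  proof (cases "x + s \<le> 0")
    case True
    then show ?thesis
      using Suc.IH[of 0] assms(1) by (simp add: max_def)
  next
    case False
    then show ?thesis
      using Suc.IH[of "x + s"] Suc.prems that by (simp add: max_def algebra_simps)
  qed
  \<comment> \<open>The integral of \<open>?f\<close> is 0 only if \<open>?f\<close> vanishes almost
    everywhere, but \<open>?f\<close> is positive on a set of positive mass.\<close>
  have "\<not> (AE s in \<Gamma>. ?f s = 0)"
  proof
    assume "AE s in \<Gamma>. ?f s = 0"
    then have "AE s in \<Gamma>. s \<notin> {..-\<epsilon>}"
      by eventually_elim (use pos in force)
    then have "emeasure \<Gamma> {..-\<epsilon>} = 0"
      by (subst (asm) AE_iff_measurable[where N = "{..-\<epsilon>}"])
         (auto simp: sets_eq sets_eq_imp_space_eq[OF sets_eq])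
    with assms(2) show False by simp
  qed
  moreover have "emeasure (half_line_kernel \<Gamma> (Suc k + m) x) A = (\<integral>\<^sup>+s. ?f s \<partial>\<Gamma>)"
    using half_line_kernel_Suc[OF \<open>0 \<le> x\<close> A] by simp
  ultimately show ?case
    using nn_integral_0_iff_AE[OF borel_measurable_half_line_kernel[OF A], of "k + m" x]
    by (simp add: zero_less_iff_neq_zero)
qed

lemma half_line_kernel_reaches:
  assumes "emeasure \<Gamma> {..<0} > 0" "A \<in> sets half_line"
    and "emeasure (half_line_kernel \<Gamma> m 0) A > 0" "0 \<le> x"
  shows "\<exists>n\<ge>1. emeasure (half_line_kernel \<Gamma> n x) A > 0"
proof -
  \<comment> \<open>These half lines exhaust \<open>{..<0}\<close>, so by countable subadditivity
    they cannot all be null.\<close>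
  have "\<exists>i. emeasure \<Gamma> {..- (1 / real (Suc i))} > 0"
  proof (rule ccontr)
    assume "\<nexists>i. emeasure \<Gamma> {..- (1 / real (Suc i))} > 0"
    then have "(\<Union>i. {..- (1 / real (Suc i))}) \<in> null_sets \<Gamma>"
      by (intro null_sets_UN) (auto simp: null_sets_def sets_eq)
    moreover have "(\<Union>i. {..- (1 / real (Suc i))}) = {..<0}"
    proof (intro equalityI subsetI)
      fix s :: real assume "s \<in> {..<0}"
      then obtain i where "1 / real (Suc i) < - s"
        using reals_Archimedean[of "- s"] by (auto simp: inverse_eq_divide)
      then show "s \<in> (\<Union>i. {..- (1 / real (Suc i))})"
        by (auto intro!: exI[of _ i])
    next
      fix s :: real assume "s \<in> (\<Union>i. {..- (1 / real (Suc i))})"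
      then obtain i where "s \<le> - (1 / real (Suc i))" by auto
      also have "\<dots> < 0" by simp
      finally show "s \<in> {..<0}" by simp
    qed
    ultimately show False
      using assms(1) by auto
  qed
  then obtain i where i: "emeasure \<Gamma> {..- (1 / real (Suc i))} > 0" ..
  obtain k where "x < real k * (1 / real (Suc i))"
    using reals_Archimedean3[of "1 / real (Suc i)"] by auto
  \<comment> \<open>Passing to \<open>Suc k\<close> makes the number of steps visibly at least
    1.\<close>
  also have "\<dots> \<le> real (Suc k) * (1 / real (Suc i))"
    by (intro mult_right_mono) auto
  finally have "emeasure (half_line_kernel \<Gamma> (Suc k + m) x) A > 0"
    using assms i by (intro half_line_kernel_pos) auto
  then show ?thesis
    by (intro exI[of _ "Suc k + m"]) auto
qed

text \<open>\<open>\<Sum>n. P n 0 A * 2 ^ -(n + 1)\<close>, that is \<open>\<psi>\<close> normalised to a probability measure.\<close>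

definition visit_measure :: "real measure" where
  "visit_measure = measure_pmf (geometric_pmf (1 / 2)) \<bind> (\<lambda>n. half_line_kernel \<Gamma> n 0)"

lemma visit_measure_kernel: "(\<lambda>n. half_line_kernel \<Gamma> n 0) \<in>
    measure_pmf (geometric_pmf (1 / 2)) \<rightarrow>\<^sub>M prob_algebra half_line"
  by (auto intro: half_line_kernel_in_prob_algebra)

lemma sets_visit_measure: "sets visit_measure = sets half_line"
  unfolding visit_measure_def
  by (rule sets_bind_measurable[OF measurable_prob_algebraD[OF visit_measure_kernel]]) simp

lemma prob_space_visit_measure: "prob_space visit_measure"
  unfolding visit_measure_def
  by (rule prob_space_bind'[OF _ visit_measure_kernel])
     (auto simp: space_prob_algebra measure_pmf.prob_space_axioms)

text \<open>The geometric law gives every \<open>n\<close> positive weight, so the mixture vanishes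
  on \<open>A\<close> only if each of its components does.\<close>

lemma visit_measure_eq_0_iff:
  assumes "A \<in> sets half_line"
  shows "emeasure visit_measure A = 0 \<longleftrightarrow> (\<forall>n. emeasure (half_line_kernel \<Gamma> n 0) A = 0)"
proof -
  have "emeasure visit_measure A
      = (\<integral>\<^sup>+n. emeasure (half_line_kernel \<Gamma> n 0) A \<partial>measure_pmf (geometric_pmf (1 / 2)))"
    unfolding visit_measure_def
    by (rule emeasure_bind[OF _ measurable_prob_algebraD[OF visit_measure_kernel] assms]) simp
  then show ?thesis
    by (simp add: nn_integral_0_iff_AE AE_measure_pmf_iff set_pmf_geometric)
qed

text \<open>A set charged by \<open>visit_measure\<close> is reached from 0, and 0 is reached from
  everywhere. Conversely, a set charged by any irreducibility measure is in particular reached from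
  0, hence charged by \<open>visit_measure\<close>.\<close>

lemma maximal_irreducibility_measure_visit_measure:
  assumes "emeasure \<Gamma> {..<0} > 0"
  shows "maximal_irreducibility_measure half_line (half_line_kernel \<Gamma>) visit_measure"
  unfolding maximal_irreducibility_measure_def
proof (intro conjI allI impI)
  interpret V: prob_space visit_measure
    by (rule prob_space_visit_measure)
  have "space visit_measure = space half_line"
    by (rule sets_eq_imp_space_eq[OF sets_visit_measure])
  moreover have "\<exists>n\<ge>1. emeasure (half_line_kernel \<Gamma> n x) A > 0"
    if A: "A \<in> sets half_line" "emeasure visit_measure A > 0" and "x \<in> space half_line" for A x
  proof -
    obtain m where "emeasure (half_line_kernel \<Gamma> m 0) A > 0"
      using A visit_measure_eq_0_iff[of A] by (auto simp: zero_less_iff_neq_zero)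
    with that assms show ?thesis
      by (intro half_line_kernel_reaches) (auto simp: space_half_line)
  qed
  ultimately show "irreducibility_measure half_line (half_line_kernel \<Gamma>) visit_measure"
    unfolding irreducibility_measure_def
    using V.emeasure_space_1 V.sigma_finite_measure_axioms
    by (auto simp: sets_visit_measure)
next
  fix \<phi> assume \<phi>: "irreducibility_measure half_line (half_line_kernel \<Gamma>) \<phi>"
  show "absolutely_continuous visit_measure \<phi>"
    unfolding absolutely_continuous_def
  proof
    fix A assume "A \<in> null_sets visit_measure"
    then have A: "A \<in> sets half_line" "\<And>n. emeasure (half_line_kernel \<Gamma> n 0) A = 0"
      using visit_measure_eq_0_iff[of A] by (auto simp: null_sets_def sets_visit_measure)
    have "emeasure \<phi> A = 0"
    proof (rule ccontr)
      assume "emeasure \<phi> A \<noteq> 0"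
      moreover have "0 \<in> space half_line"
        by (simp add: space_half_line)
      ultimately obtain n where "emeasure (half_line_kernel \<Gamma> n 0) A > 0"
        using \<phi> A(1) unfolding irreducibility_measure_def zero_less_iff_neq_zero by blast
      with A(2) show False
        by simp
    qed
    then show "A \<in> null_sets \<phi>"
      using A \<phi> by (auto simp: irreducibility_measure_def null_sets_def)
  qed
qed

section \<open>Geometric decay\<close>

text \<open>Induction over the first step, with the start left general. Reflection only raises the
  walk, so the exponential weight is at most its unreflected value, and each step contributes one
  factor of the exponential moment, which may be infinite here.\<close>

lemma half_line_kernel_Chernoff:
  assumes "0 \<le> t" "0 \<le> x"
  shows "emeasure (half_line_kernel \<Gamma> n x) {0..c}
      \<le> ennreal (exp (t * (c - x))) * (\<integral>\<^sup>+u. ennreal (exp (- t * u)) \<partial>\<Gamma>) ^ n"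
proof -
  note sets = atLeastAtMost_half_line[of c]
  let ?M = "\<integral>\<^sup>+u. ennreal (exp (- t * u)) \<partial>\<Gamma>"
  show ?thesis
    using assms(2)
  proof (induction n arbitrary: x)
    case 0
    \<comment> \<open>For \<open>x \<le> c\<close> the exponential is at least 1 and thus dominates
      the indicator, as in Markov's inequality.\<close>
    then show ?case
      using assms(1) sets by (auto simp: half_line_kernel_0 indicator_def)
  next
    case (Suc n)
    have "emeasure (half_line_kernel \<Gamma> (Suc n) x) {0..c}
        = (\<integral>\<^sup>+s. emeasure (half_line_kernel \<Gamma> n (max 0 (x + s))) {0..c} \<partial>\<Gamma>)"
      using Suc.prems sets by (rule half_line_kernel_Suc)
    also have "\<dots> \<le> (\<integral>\<^sup>+s. (ennreal (exp (t * (c - x))) * ?M ^ n) * ennreal (exp (- t * s)) \<partial>\<Gamma>)"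
    proof (rule nn_integral_mono)
      fix s
      have "emeasure (half_line_kernel \<Gamma> n (max 0 (x + s))) {0..c}
          \<le> ennreal (exp (t * (c - max 0 (x + s)))) * ?M ^ n"
        by (rule Suc.IH) simp
      also have "\<dots> \<le> ennreal (exp (t * (c - (x + s)))) * ?M ^ n"
        using assms(1) by (intro mult_right_mono ennreal_leI) (auto intro!: mult_left_mono)
      also have "exp (t * (c - (x + s))) = exp (t * (c - x)) * exp (- t * s)"
        by (simp add: exp_add [symmetric] algebra_simps)
      finally show "emeasure (half_line_kernel \<Gamma> n (max 0 (x + s))) {0..c}
          \<le> (ennreal (exp (t * (c - x))) * ?M ^ n) * ennreal (exp (- t * s))"
        by (simp add: ennreal_mult mult_ac)
    qed
    also have "\<dots> = (ennreal (exp (t * (c - x))) * ?M ^ n) * ?M"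
      by (rule nn_integral_cmult) measurable
    finally show ?case
      by (simp add: mult_ac)
  qed
qed

end

section \<open>Exponential moments below 1\<close>

lemma exp_quotient_mono:
  fixes u :: real
  assumes "0 < t" "t \<le> g"
  shows "(exp (- t * u) - 1) / t \<le> (exp (- g * u) - 1) / g"
proof -
  \<comment> \<open>Convexity of \<open>exp\<close> along the chord from 0 to
    \<open>- g * u\<close>, at the fraction \<open>t / g\<close>.\<close>
  have "exp (t / g * (- g * u)) \<le> (1 - t / g) + t / g * exp (- g * u)"
    using assms convex_onD[OF exp_convex, of "t / g" 0 "- g * u"] by simp
  moreover have "t / g * (- g * u) = - t * u"
    using assms by simp
  ultimately have "exp (- t * u) - 1 \<le> (exp (- g * u) - 1) / g * t"
    by (simp add: diff_divide_distrib algebra_simps)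
  then show ?thesis
    using assms by (simp add: pos_divide_le_eq)
qed

text \<open>
  The difference quotients \<open>(1 - exp (- t * u)) / t\<close> tend to \<open>u\<close> as \<open>t \<rightarrow> 0\<close>. Fatou's lemma on the
  positive parts and dominated convergence on the negative parts carry the positivity of the mean
  over to the quotients for small \<open>t\<close>; the mean of the positive part may be infinite.
\<close>

lemma exp_moment_less_1:
  fixes \<Gamma> :: "real measure"
  assumes "prob_space \<Gamma>" and sets_eq [measurable_cong]: "sets \<Gamma> = sets borel"
    and "extended_mean \<Gamma> > 0" and "0 < \<gamma>"
    and fin: "(\<integral>\<^sup>+x\<in>{..0}. ennreal (exp (- \<gamma> * x)) \<partial>\<Gamma>) < \<infinity>"
  obtains t where "0 < t" "(\<integral>\<^sup>+u. ennreal (exp (- t * u)) \<partial>\<Gamma>) < 1"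
proof -
  interpret prob_space \<Gamma> by fact
  \<comment> \<open>A sequence that starts at \<open>\<gamma>\<close> and decreases to 0: all terms
    are bounded by \<open>\<gamma>\<close>, and the convergence theorems for sequences
    apply.\<close>
  define t where "t k = \<gamma> / real (Suc k)" for k
  have t: "0 < t k" "t k \<le> \<gamma>" for k
    using \<open>0 < \<gamma>\<close> by (auto simp: t_def field_simps)
  have t0: "filterlim t (at 0) sequentially"
  proof (rule filterlim_atI)
    show "t \<longlonglongrightarrow> 0"
      unfolding t_def using LIMSEQ_Suc[OF lim_const_over_n[of \<gamma>]] by simp
    show "\<forall>\<^sub>F k in sequentially. t k \<noteq> 0"
      using t by (intro always_eventually) (auto simp: less_imp_neq[symmetric])
  qed
  \<comment> \<open>The difference quotient of \<open>exp (- h * u)\<close> in \<open>h\<close> at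
    0, with limit \<open>- u\<close>; its positive part lives on \<open>u \<le> 0\<close>.\<close>
  define q where "q k u = (exp (- t k * u) - 1) / t k" for k u
  have [measurable]: "q k \<in> borel_measurable borel" for k
    unfolding q_def by measurable
  have q_lim: "(\<lambda>k. q k u) \<longlonglongrightarrow> - u" for u
  proof -
    have "((\<lambda>h. exp (- h * u)) has_real_derivative - u) (at 0)"
      by (auto intro!: derivative_eq_intros)
    then have "((\<lambda>h. (exp (- h * u) - 1) / h) \<longlongrightarrow> - u) (at 0)"
      by (simp add: DERIV_def)
    from filterlim_compose[OF this t0] show ?thesis
      by (simp add: q_def)
  qed
  \<comment> \<open>Dominates the positive parts of all \<open>q k\<close>: the quotient at
    \<open>\<gamma>\<close> bounds them by monotonicity, and dropping its \<open>- 1\<close> leaves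
    the integrand of \<open>fin\<close> up to the factor \<open>1 / \<gamma>\<close>.\<close>
  define w where "w u = ennreal (exp (- \<gamma> * u) / \<gamma>) * indicator {..0} u" for u
  have q_le_w: "ennreal (q k u) \<le> w u" for k u
  proof (cases "u \<le> 0")
    case True
    have "q k u \<le> (exp (- \<gamma> * u) - 1) / \<gamma>"
      unfolding q_def using t by (rule exp_quotient_mono)
    also have "\<dots> \<le> exp (- \<gamma> * u) / \<gamma>"
      using \<open>0 < \<gamma>\<close> by (intro divide_right_mono) auto
    finally show ?thesis
      using True by (simp add: w_def ennreal_leI)
  next
    case False
    then have "q k u \<le> 0"
      using t[of k] by (auto simp: q_def divide_nonpos_pos)
    then show ?thesis
      by (simp add: w_def ennreal_neg)
  qed
  have w_fin: "(\<integral>\<^sup>+u. w u \<partial>\<Gamma>) < \<infinity>"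
  proof -
    have "(\<integral>\<^sup>+u. w u \<partial>\<Gamma>)
        = (\<integral>\<^sup>+u. ennreal (1 / \<gamma>) * (ennreal (exp (- \<gamma> * u)) * indicator {..0} u) \<partial>\<Gamma>)"
      using \<open>0 < \<gamma>\<close>
      by (intro nn_integral_cong)
         (auto simp: w_def ennreal_mult [symmetric] indicator_def field_simps)
    also have "\<dots> = ennreal (1 / \<gamma>) * (\<integral>\<^sup>+x\<in>{..0}. ennreal (exp (- \<gamma> * x)) \<partial>\<Gamma>)"
      by (rule nn_integral_cmult) measurable
    finally show ?thesis
      using fin by (simp add: ennreal_mult_less_top)
  qed
  have [measurable]: "w \<in> borel_measurable borel"
    unfolding w_def by measurable
  define a where "a = (\<integral>\<^sup>+u. ennreal u \<partial>\<Gamma>)"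
  define b where "b = (\<integral>\<^sup>+u. ennreal (- u) \<partial>\<Gamma>)"
  have b_lim: "(\<lambda>k. \<integral>\<^sup>+u. ennreal (q k u) \<partial>\<Gamma>) \<longlonglongrightarrow> b"
    unfolding b_def
    by (rule nn_integral_dominated_convergence[where w = w])
       (use q_le_w w_fin q_lim in \<open>auto intro!: tendsto_ennrealI\<close>)
  have neg_le_w: "ennreal (- u) \<le> w u" for u
    using q_le_w by (intro LIMSEQ_le_const2[OF tendsto_ennrealI[OF q_lim]]) auto
  then have "b \<le> (\<integral>\<^sup>+u. w u \<partial>\<Gamma>)"
    unfolding b_def by (intro nn_integral_mono) auto
  with w_fin have "b < \<infinity>"
    by (rule le_less_trans[rotated])
  \<comment> \<open>As \<open>b\<close> is finite, the extended difference of \<open>a\<close> and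
    \<open>b\<close> is positive exactly if \<open>b < a\<close>, also when \<open>a\<close> is
    infinite.\<close>
  have "b < a"
  proof -
    have "enn2ereal b < enn2ereal a"
      using \<open>extended_mean \<Gamma> > 0\<close> \<open>b < \<infinity>\<close> unfolding extended_mean_def a_def[symmetric] b_def[symmetric]
      by (cases a; cases b) (auto simp: enn2ereal_ennreal)
    then show ?thesis
      by (simp add: less_ennreal.rep_eq)
  qed
  \<comment> \<open>A fixed level between \<open>b\<close> and \<open>a\<close> separates the two
    families of integrals for all large \<open>k\<close>: Fatou keeps one above it, convergence the
    other below.\<close>
  then obtain m where m: "b < m" "m < a"
    using dense by blast
  have "a = (\<integral>\<^sup>+u. liminf (\<lambda>k. ennreal (- q k u)) \<partial>\<Gamma>)"
    unfolding a_def
  proof (intro nn_integral_cong)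
    fix u
    have "(\<lambda>k. ennreal (- q k u)) \<longlonglongrightarrow> ennreal u"
      using tendsto_minus[OF q_lim[of u]] by (auto intro!: tendsto_ennrealI)
    then show "ennreal u = liminf (\<lambda>k. ennreal (- q k u))"
      by (intro lim_imp_Liminf[symmetric]) auto
  qed
  also have "\<dots> \<le> liminf (\<lambda>k. \<integral>\<^sup>+u. ennreal (- q k u) \<partial>\<Gamma>)"
    by (rule nn_integral_liminf) measurable
  finally have "m < liminf (\<lambda>k. \<integral>\<^sup>+u. ennreal (- q k u) \<partial>\<Gamma>)"
    using m by order
  then have "\<forall>\<^sub>F k in sequentially. m < (\<integral>\<^sup>+u. ennreal (- q k u) \<partial>\<Gamma>)"
    by (rule less_LiminfD)
  moreover have "\<forall>\<^sub>F k in sequentially. (\<integral>\<^sup>+u. ennreal (q k u) \<partial>\<Gamma>) < m"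
    using b_lim m(1) by (rule order_tendstoD)
  ultimately have "\<forall>\<^sub>F k in sequentially.
      (\<integral>\<^sup>+u. ennreal (q k u) \<partial>\<Gamma>) < (\<integral>\<^sup>+u. ennreal (- q k u) \<partial>\<Gamma>)"
    by eventually_elim order
  then obtain k where k: "(\<integral>\<^sup>+u. ennreal (q k u) \<partial>\<Gamma>) < (\<integral>\<^sup>+u. ennreal (- q k u) \<partial>\<Gamma>)"
    by (auto simp: eventually_sequentially)
  define M where "M = (\<integral>\<^sup>+u. ennreal (exp (- t k * u)) \<partial>\<Gamma>)"
  \<comment> \<open>The identity \<open>exp (- t k * u) = 1 + t k * q k u\<close> is integrated with
    the negative part of \<open>q k\<close> moved to the left, because \<open>ennreal\<close>
    truncates negative values.\<close>
  have "M + ennreal (t k) * (\<integral>\<^sup>+u. ennreal (- q k u) \<partial>\<Gamma>)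
      = (\<integral>\<^sup>+u. ennreal (exp (- t k * u)) + ennreal (t k) * ennreal (- q k u) \<partial>\<Gamma>)"
    by (simp add: M_def nn_integral_add nn_integral_cmult)
  also have "\<dots> = (\<integral>\<^sup>+u. 1 + ennreal (t k) * ennreal (q k u) \<partial>\<Gamma>)"
  proof (intro nn_integral_cong)
    fix u
    have e: "exp (- t k * u) = 1 + t k * q k u"
      using t[of k] by (simp add: q_def)
    show "ennreal (exp (- t k * u)) + ennreal (t k) * ennreal (- q k u)
        = 1 + ennreal (t k) * ennreal (q k u)"
    proof (cases "q k u \<ge> 0")
      case True
      then show ?thesis
        unfolding e using t[of k] by (simp add: ennreal_neg ennreal_mult)
    next
      case False
      have "ennreal (exp (- t k * u)) + ennreal (t k) * ennreal (- q k u)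
          = ennreal (exp (- t k * u) + t k * (- q k u))"
        using False t[of k] ennreal_mult[of "t k" "- q k u"]
        by (subst ennreal_plus) (auto simp: mult_nonneg_nonpos)
      also have "\<dots> = 1"
        unfolding e by simp
      finally show ?thesis
        using False by (simp add: ennreal_neg)
    qed
  qed
  also have "\<dots> = 1 + ennreal (t k) * (\<integral>\<^sup>+u. ennreal (q k u) \<partial>\<Gamma>)"
    by (simp add: nn_integral_add nn_integral_cmult emeasure_space_1)
  finally have eq: "M + ennreal (t k) * (\<integral>\<^sup>+u. ennreal (- q k u) \<partial>\<Gamma>)
      = 1 + ennreal (t k) * (\<integral>\<^sup>+u. ennreal (q k u) \<partial>\<Gamma>)" .
  have "ennreal (t k) * (\<integral>\<^sup>+u. ennreal (q k u) \<partial>\<Gamma>) < ennreal (t k) * (\<integral>\<^sup>+u. ennreal (- q k u) \<partial>\<Gamma>)"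
    using k t[of k] by (intro ennreal_mult_strict_left_mono) auto
  then have "1 + ennreal (t k) * (\<integral>\<^sup>+u. ennreal (q k u) \<partial>\<Gamma>)
      < 1 + ennreal (t k) * (\<integral>\<^sup>+u. ennreal (- q k u) \<partial>\<Gamma>)"
    by (simp add: ennreal_add_left_cancel_less)
  \<comment> \<open>With \<open>1 \<le> M\<close> the left side of \<open>eq\<close> would be at
    least the right side of the strict inequality just shown. This avoids cancelling an integral in
    \<open>ennreal\<close>.\<close>
  then have "M < 1"
    unfolding eq [symmetric] by (meson add_right_mono not_less)
  with t[of k] show thesis
    by (intro that[of "t k"]) (auto simp: M_def)
qed

section \<open>Uniform geometric transience of the intervals from 0 to i\<close>

theorem theorem4p2:
  fixes \<Gamma> :: "real measure"
  assumes "prob_space \<Gamma>" and "sets \<Gamma> = sets borel"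
    and "emeasure \<Gamma> {..<0} > 0"
    and "extended_mean \<Gamma> > 0"
    and "\<exists>\<gamma>>0. (\<integral>\<^sup>+x\<in>{..0}. ennreal (exp (- \<gamma> * x)) \<partial>\<Gamma>) < \<infinity>"
  shows "geometrically_transient half_line (half_line_kernel \<Gamma>)"
proof -
  note \<Gamma> = assms(1,2)
  define M where "M t = (\<integral>\<^sup>+u. ennreal (exp (- t * u)) \<partial>\<Gamma>)" for t
  obtain \<gamma> where "0 < \<gamma>" "(\<integral>\<^sup>+x\<in>{..0}. ennreal (exp (- \<gamma> * x)) \<partial>\<Gamma>) < \<infinity>"
    using assms(5) by auto
  then obtain t where t: "0 < t" "M t < 1"
    unfolding M_def by (rule exp_moment_less_1[OF \<Gamma> assms(4)])
  \<comment> \<open>A real number strictly between \<open>M t\<close> and 1 leaves room for the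
    rate; its positivity makes \<open>1 / m\<close> meaningful.\<close>
  obtain m where m: "M t < ennreal m" "0 < m" "m < 1"
  proof -
    obtain e where e: "M t < e" "e < 1"
      using t(2) dense by blast
    have "0 < e" "e < top"
      using le_less_trans[OF zero_le e(1)] less_trans[OF e(2) ennreal_one_less_top] by auto
    then have "e = ennreal (enn2real e)" "0 < enn2real e"
      by (auto simp: enn2real_positive_iff)
    with e show thesis
      using that[of "enn2real e"] by (metis ennreal_less_one_iff)
  qed
  \<comment> \<open>The midpoint of 1 and \<open>1 / m\<close>, so that
    \<open>\<kappa> * m = (m + 1) / 2 < 1\<close>.\<close>
  define \<kappa> where "\<kappa> = (1 + 1 / m) / 2"
  have \<kappa>: "\<kappa> > 1" "\<kappa> * m < 1" "0 \<le> \<kappa> * m"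
    using m by (auto simp: \<kappa>_def field_simps)
  note sets = atLeastAtMost_half_line
  have "uniformly_geometric_transient half_line (half_line_kernel \<Gamma>) (visit_measure \<Gamma>) {0..real i}"
    for i
    unfolding uniformly_geometric_transient_def
  proof (intro conjI exI[of _ \<kappa>])
    \<comment> \<open>\<open>visit_measure\<close> counts time 0, when the walk started in 0 lies in
      the interval.\<close>
    have "emeasure (half_line_kernel \<Gamma> 0 0) {0..real i} = 1"
      by (simp add: half_line_kernel_0[OF \<Gamma>] sets)
    then show "emeasure (visit_measure \<Gamma>) {0..real i} > 0"
      using visit_measure_eq_0_iff[OF \<Gamma> sets] by (metis zero_less_iff_neq_zero zero_neq_one)
    \<comment> \<open>Uniform in \<open>x\<close>: the prefactor
      \<open>exp (t * (real i - x))\<close> is largest at \<open>x = 0\<close>, and the rest is a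
      geometric series of ratio \<open>\<kappa> * m\<close>.\<close>
    let ?C = "ennreal (exp (t * real i)) * ennreal (\<Sum>n. (\<kappa> * m) ^ Suc n)"
    have "(\<Sum>n. ennreal (\<kappa> ^ Suc n) * emeasure (half_line_kernel \<Gamma> (Suc n) x) {0..real i}) \<le> ?C"
      if "x \<in> {0..real i}" for x
    proof -
      have "(\<Sum>n. ennreal (\<kappa> ^ Suc n) * emeasure (half_line_kernel \<Gamma> (Suc n) x) {0..real i})
          \<le> (\<Sum>n. ennreal (exp (t * real i)) * ennreal ((\<kappa> * m) ^ Suc n))"
      proof (intro suminf_le)
        fix n
        have "emeasure (half_line_kernel \<Gamma> (Suc n) x) {0..real i}
            \<le> ennreal (exp (t * (real i - x))) * M t ^ Suc n"
          unfolding M_def using that t(1) by (intro half_line_kernel_Chernoff[OF \<Gamma>]) auto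
        also have "\<dots> \<le> ennreal (exp (t * real i)) * ennreal m ^ Suc n"
          using that t(1) m(1)
          by (intro mult_mono power_mono ennreal_leI) (auto simp: less_imp_le)
        also have "\<dots> = ennreal (exp (t * real i)) * ennreal (m ^ Suc n)"
          using m by (simp only: ennreal_power less_imp_le)
        finally have "ennreal (\<kappa> ^ Suc n) * emeasure (half_line_kernel \<Gamma> (Suc n) x) {0..real i}
            \<le> ennreal (\<kappa> ^ Suc n) * (ennreal (exp (t * real i)) * ennreal (m ^ Suc n))"
          by (rule mult_left_mono) simp
        also have "\<dots> = ennreal (exp (t * real i)) * ennreal ((\<kappa> * m) ^ Suc n)"
          using \<kappa>(1) m ennreal_mult[of "\<kappa> ^ Suc n" "m ^ Suc n"]
          by (simp add: power_mult_distrib mult_ac del: power_Suc)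
        finally show "ennreal (\<kappa> ^ Suc n) * emeasure (half_line_kernel \<Gamma> (Suc n) x) {0..real i}
            \<le> ennreal (exp (t * real i)) * ennreal ((\<kappa> * m) ^ Suc n)" .
      qed auto
      also have "\<dots> = ?C"
        using \<kappa> by (subst ennreal_suminf_cmult, subst suminf_ennreal2)
          (auto simp: summable_geometric summable_mult simp del: ennreal_suminf_neq_top)
      finally show ?thesis .
    qed
    then have "(SUP x\<in>{0..real i}. \<Sum>n. ennreal (\<kappa> ^ Suc n) *
        emeasure (half_line_kernel \<Gamma> (Suc n) x) {0..real i}) \<le> ?C"
      by (rule SUP_least)
    also have "\<dots> < \<infinity>"
      by (simp add: ennreal_mult_less_top)
    finally show "(SUP x\<in>{0..real i}. \<Sum>n. ennreal (\<kappa> ^ Suc n) *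
        emeasure (half_line_kernel \<Gamma> (Suc n) x) {0..real i}) < \<infinity>" .
  qed (use \<kappa> sets in auto)
  moreover have "space half_line = {} \<union> (\<Union>i. {0..real i})"
    by (auto simp: space_half_line intro: real_arch_simple)
  ultimately show ?thesis
    unfolding geometrically_transient_def
    using maximal_irreducibility_measure_visit_measure[OF \<Gamma> assms(3)]
    by (intro exI[of _ "visit_measure \<Gamma>"] conjI exI[of _ "{}"] exI[of _ "\<lambda>i. {0..real i}"]) auto
qed

end
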